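(* Let $(A,\circ)$ be a finite-dimensional solvable Novikov algebra over $\mathbf{k}$ with $A\circ A\neq 0$ and $\operatorname{Ann}_A(A)\neq 0$. Then there is a non-trivial transposed Novikov-Poisson algebra structure on $(A,\circ)$.
   Context: $\mathbf{k}$ is a field of characteristic not equal to $2$; all binary operations are $\mathbf{k}$-bilinear and algebras need not be unital. A (left) Novikov algebra $(A,\circ)$ is a vector space with a binary operation satisfying $(x\circ y)\circ z=(x\circ z)\circ y$ and $(x\circ y)\circ z-x\circ(y\circ z)=(y\circ x)\circ z-y\circ(x\circ z)$ for all $x,y,z$. For subspaces $U,V$, $U\circ V$ is the span of all $u\circ v$. Put $A^{(0)}=A$ and $A^{(n)}=A^{(n-1)}\circ A^{(n-1)}$ for $n\geq1$; $(A,\circ)$ is solvable if $A^{(n)}=\{0\}$ for some $n\geq 1$. $\operatorname{Ann}_A(A)=\{a\in A\mid a\circ x=x\circ a=0\ \text{for all }x\in A\}$. A transposed Novikov-Poisson algebra is a triple $(A,\cdot,\circ)$ where $(A,\cdot)$ is a commutative associative algebra, $(A,\circ)$ is a Novikov algebra, and for all $x,y,z\in A$: $(x\cdot y)\circ z=(x\cdot z)\circ y$ and $2z\cdot(x\circ y)=(z\cdot x)\circ y+x\circ(z\cdot y)$. It is trivial if $\cdot$ is zero or $\circ$ is zero. A non-trivial transposed Novikov-Poisson algebra structure on $(A,\circ)$ is an operation $\cdot$ on $A$ such that $(A,\cdot,\circ)$ is a transposed Novikov-Poisson algebra that is not trivial. *)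

theory Defs
  imports "HOL-Computational_Algebra.Computational_Algebra"
begin

locale bilinear_algebra = vector_space scale
  for scale :: "'k::field \<Rightarrow> 'a::ab_group_add \<Rightarrow> 'a" (infixr \<open>*s\<close> 75) +
  fixes mul :: "'a \<Rightarrow> 'a \<Rightarrow> 'a" (infixl \<open>\<star>\<close> 70)
  assumes linear_right: "Vector_Spaces.linear scale scale (\<lambda>y. x \<star> y)"
    and linear_left: "Vector_Spaces.linear scale scale (\<lambda>x. x \<star> y)"
begin

definition set_mul :: "'a set \<Rightarrow> 'a set \<Rightarrow> 'a set" where
  "set_mul U V = span {u \<star> v |u v. u \<in> U \<and> v \<in> V}"

primrec derived :: "nat \<Rightarrow> 'a set" where
  "derived 0 = UNIV"
| "derived (Suc n) = set_mul (derived n) (derived n)"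

definition solvable :: bool where
  "solvable \<longleftrightarrow> (\<exists>n\<ge>1. derived n = {0})"

definition Ann :: "'a set" where
  "Ann = {a. \<forall>x. a \<star> x = 0 \<and> x \<star> a = 0}"

end

locale novikov_algebra = bilinear_algebra +
  assumes right_comm: "(x \<star> y) \<star> z = (x \<star> z) \<star> y"
    and left_sym: "(x \<star> y) \<star> z - x \<star> (y \<star> z) = (y \<star> x) \<star> z - y \<star> (x \<star> z)"

locale comm_assoc_algebra = bilinear_algebra +
  assumes mul_comm: "x \<star> y = y \<star> x"
    and mul_assoc: "(x \<star> y) \<star> z = x \<star> (y \<star> z)"

(* dot is the commutative product, mul the Novikov product written as a circle in the literature.
   Both share the linear structure given by scale. *)
locale transposed_novikov_poisson_algebra =
  dot: comm_assoc_algebra scale dot + circ: novikov_algebra scale mul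
  for scale :: "'k::field \<Rightarrow> 'a::ab_group_add \<Rightarrow> 'a" (infixr \<open>*s\<close> 75)
    and dot :: "'a \<Rightarrow> 'a \<Rightarrow> 'a" (infixl \<open>\<odot>\<close> 70)
    and mul :: "'a \<Rightarrow> 'a \<Rightarrow> 'a" (infixl \<open>\<star>\<close> 70) +
  assumes dot_mul: "(x \<odot> y) \<star> z = (x \<odot> z) \<star> y"
    and two_dot_mul: "2 *s (z \<odot> (x \<star> y)) = (z \<odot> x) \<star> y + x \<star> (z \<odot> y)"

definition trivial_tnp ::
    "('a::ab_group_add \<Rightarrow> 'a \<Rightarrow> 'a) \<Rightarrow> ('a \<Rightarrow> 'a \<Rightarrow> 'a) \<Rightarrow> bool" where
  "trivial_tnp dot mul \<longleftrightarrow> (\<forall>x y. dot x y = 0) \<or> (\<forall>x y. mul x y = 0)"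

definition nontrivial_tnp_structure ::
    "('k::field \<Rightarrow> 'a::ab_group_add \<Rightarrow> 'a) \<Rightarrow> ('a \<Rightarrow> 'a \<Rightarrow> 'a) \<Rightarrow> ('a \<Rightarrow> 'a \<Rightarrow> 'a) \<Rightarrow> bool" where
  "nontrivial_tnp_structure scale mul dot \<longleftrightarrow>
     transposed_novikov_poisson_algebra scale dot mul \<and> \<not> trivial_tnp dot mul"

end

theory Submission
  imports Defs
begin

text \<open>
  A structure of rank one suffices. Choose a nonzero linear functional \<open>f\<close> vanishing on
  \<open>A \<circ> A\<close> and a nonzero \<open>a\<close> in the annihilator, and put \<open>x \<cdot> y = f x f y a\<close>.
  In both compatibility identities every term is zero for one of two reasons: a Novikov product
  with a multiple of \<open>a\<close> as a factor vanishes because \<open>a\<close> annihilates, and a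
  \<open>\<cdot>\<close>-product with a Novikov product as a factor vanishes because \<open>f\<close> kills
  \<open>A \<circ> A\<close>. Associativity holds even if \<open>f a\<close> is nonzero, since
  \<open>(x \<cdot> y) \<cdot> z = f x f y f z f a a\<close> is symmetric in \<open>x, y, z\<close>.

  Solvability is what provides \<open>f\<close>: if \<open>A \<circ> A = A\<close>, then every term of the derived
  series is \<open>A\<close>, so the series never reaches \<open>0\<close>. Hence \<open>A \<circ> A\<close> is a proper
  subspace, and a proper subspace is contained in the kernel of a nonzero functional.
\<close>

lemma (in vector_space) nonzero_functional_vanishing_on_proper_subspace:
  assumes "subspace U" and "U \<noteq> UNIV"
  obtains f :: "'b \<Rightarrow> 'a" and x
  where "Vector_Spaces.linear scale (*) f" and "\<And>u. u \<in> U \<Longrightarrow> f u = 0" and "f x \<noteq> 0"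
proof -
  interpret field: vector_space "(*) :: 'a \<Rightarrow> 'a \<Rightarrow> 'a"
    by unfold_locales (simp_all add: algebra_simps)
  interpret to_field: vector_space_pair scale "(*) :: 'a \<Rightarrow> 'a \<Rightarrow> 'a" ..
  obtain x where x: "x \<notin> U"
    using assms(2) by blast
  obtain B where B: "B \<subseteq> U" "independent B" "span B = U"
    using basis_exists[of U] assms(1) by (metis span_minimal subset_antisym)
  have "independent (insert x B)"
    using B x by (simp add: independent_insert)
  then obtain f where f: "Vector_Spaces.linear scale (*) f"
      and f_basis: "\<forall>b\<in>insert x B. f b = (if b = x then 1 else 0)"
    using to_field.linear_independent_extend[of "insert x B" "\<lambda>b. if b = x then 1 else 0"] by blast
  have "f b = 0" if "b \<in> B" for b
    using that f_basis B x by auto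
  then have "f u = 0" if "u \<in> U" for u
    using to_field.linear_eq_0_on_span[OF f, of B u] that B by auto
  moreover have "f x \<noteq> 0"
    using f_basis by simp
  ultimately show thesis
    using f that by blast
qed

context bilinear_algebra
begin

lemma mul_0_left: "0 \<star> y = 0"
proof -
  interpret L: Vector_Spaces.linear scale scale "\<lambda>x. x \<star> y"
    by (rule linear_left)
  show ?thesis by (rule L.zero)
qed

lemma mul_0_right: "x \<star> 0 = 0"
proof -
  interpret R: Vector_Spaces.linear scale scale "\<lambda>y. x \<star> y"
    by (rule linear_right)
  show ?thesis by (rule R.zero)
qed

lemma scale_mem_Ann:
  assumes "a \<in> Ann"
  shows "c *s a \<in> Ann"
proof -
  have "(c *s a) \<star> x = 0" for x
  proof -
    interpret L: Vector_Spaces.linear scale scale "\<lambda>z. z \<star> x"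
      by (rule linear_left)
    show ?thesis
      using assms by (simp add: L.scale Ann_def)
  qed
  moreover have "x \<star> (c *s a) = 0" for x
  proof -
    interpret R: Vector_Spaces.linear scale scale "\<lambda>z. x \<star> z"
      by (rule linear_right)
    show ?thesis
      using assms by (simp add: R.scale Ann_def)
  qed
  ultimately show ?thesis
    by (simp add: Ann_def)
qed

text \<open>A perfect algebra has a constant derived series.\<close>

lemma solvable_imp_set_mul_UNIV_proper:
  assumes solvable and "set_mul UNIV UNIV \<noteq> {0}"
  shows "set_mul UNIV UNIV \<noteq> UNIV"
proof
  assume perfect: "set_mul UNIV UNIV = UNIV"
  have "derived n = UNIV" for n
    by (induction n) (simp_all add: perfect)
  then show False
    using assms perfect by (auto simp: solvable_def)
qed

lemma set_mul_UNIV_eq_0: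
  assumes "\<And>x y. x \<star> y = 0"
  shows "set_mul UNIV UNIV = {0}"
  using assms by (simp add: set_mul_def)

end

lemma (in vector_space) rank_one_comm_assoc_algebra:
  assumes "Vector_Spaces.linear scale (*) f"
  shows "comm_assoc_algebra scale (\<lambda>x y. scale (f x * f y) a)"
proof -
  interpret f: Vector_Spaces.linear scale "(*)" f
    by (rule assms)
  show ?thesis
    by unfold_locales (simp_all add: f.add f.scale distrib_left distrib_right scale_left_distrib)
qed

lemma (in novikov_algebra) rank_one_transposed_novikov_poisson_algebra:
  assumes f: "Vector_Spaces.linear scale (*) f"
    and f_mul: "\<And>x y. f (x \<star> y) = 0"
    and a: "a \<in> Ann"
  shows "transposed_novikov_poisson_algebra scale (\<lambda>x y. (f x * f y) *s a) (\<star>)"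
proof -
  interpret dot: comm_assoc_algebra scale "\<lambda>x y. (f x * f y) *s a"
    using f by (rule rank_one_comm_assoc_algebra)
  have "(c *s a) \<star> x = 0" "x \<star> (c *s a) = 0" for c x
    using scale_mem_Ann[OF a] by (auto simp: Ann_def)
  then show ?thesis
    by unfold_locales (simp_all add: f_mul)
qed

theorem corollary3p15:
  fixes scale :: "'k::field \<Rightarrow> 'a::ab_group_add \<Rightarrow> 'a"
    and mul :: "'a \<Rightarrow> 'a \<Rightarrow> 'a"
    and Basis :: "'a set"
  assumes "CHAR('k) \<noteq> 2"
    and "finite_dimensional_vector_space scale Basis"
    and "novikov_algebra scale mul"
    and "bilinear_algebra.solvable scale mul"
    and "bilinear_algebra.set_mul scale mul UNIV UNIV \<noteq> {0}"
    and "bilinear_algebra.Ann mul \<noteq> {0}"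
  shows "\<exists>dot. nontrivial_tnp_structure scale mul dot"
proof -
  interpret novikov_algebra scale mul
    by (rule assms(3))
  let ?AA = "set_mul UNIV UNIV"
  have "0 \<in> Ann"
    by (simp add: Ann_def mul_0_left mul_0_right)
  then obtain a where a: "a \<in> Ann" "a \<noteq> 0"
    using assms(6) by blast
  have "subspace ?AA"
    by (simp add: set_mul_def)
  moreover have "?AA \<noteq> UNIV"
    using assms(4,5) by (rule solvable_imp_set_mul_UNIV_proper)
  ultimately obtain f x where f: "Vector_Spaces.linear scale (*) f"
      and f_AA: "\<And>u. u \<in> ?AA \<Longrightarrow> f u = 0" and fx: "f x \<noteq> 0"
    by (rule nonzero_functional_vanishing_on_proper_subspace) blast
  have "mul u v \<in> ?AA" for u v
    unfolding set_mul_def by (rule span_base) blast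
  then have "f (mul u v) = 0" for u v
    by (simp add: f_AA)
  with f have "transposed_novikov_poisson_algebra scale (\<lambda>x y. scale (f x * f y) a) mul"
    using a(1) by (rule rank_one_transposed_novikov_poisson_algebra)
  moreover have "\<not> trivial_tnp (\<lambda>x y. scale (f x * f y) a) mul"
  proof -
    have "scale (f x * f x) a \<noteq> 0"
      using fx a(2) by simp
    moreover have "\<exists>u v. mul u v \<noteq> 0"
      using assms(5) set_mul_UNIV_eq_0 by blast
    ultimately show ?thesis
      unfolding trivial_tnp_def by blast
  qed
  ultimately show ?thesis
    unfolding nontrivial_tnp_structure_def by blast
qed

end
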